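(* For every $n\ge 1$, every $\varepsilon\in(0,(2n)^{-1}]$, and every finite subset $\mathcal{M}\subset\mathcal{D}_{n,\varepsilon}$, the set $\mathcal{A}_n$ of averagings is a convergence core of $\mathcal{M}$ (in the convergent semigroup $\mathcal{D}_{n,\varepsilon}$).
   Context: $\mathcal{D}_n$ is the set of $n\times n$ doubly stochastic matrices (non-negative real, every row and column sums to $1$). For $\varepsilon\in(0,(2n)^{-1}]$, a matrix $M\in\mathcal{D}_n$ is $\varepsilon$-domestic if there do not exist subsets $X,Y\subseteq\{1,\ldots,n\}$ with $X\neq Y$, $|X|=|Y|$ and $\sum_{i\in X,j\in Y}M[i,j]>(1-\varepsilon)|X|$. $\mathcal{D}_{n,\varepsilon}$ is the set of all $\varepsilon$-domestic matrices in $\mathcal{D}_n$; it is a topological semigroup under matrix multiplication and the standard topology, and it is convergent, i.e. every (right) infinite product $\prod_{i\in\mathbb{N}}S_i:=\lim_{i\to\infty}S_0S_1\cdots S_i$ of its elements exists in it. A matrix $A\in\mathcal{D}_n$ is the averaging over a partition $P_1\sqcup\cdots\sqcup P_s=\{1,\ldots,n\}$ if $A[i,j]=1/|P_t|$ when $i,j\in P_t$ for some $t$, and $A[i,j]=0$ otherwise. $\mathcal{A}_n$ is the set of all averagings in $\mathcal{D}_n$; one has $\mathcal{A}_n\subset\mathcal{D}_{n,\varepsilon}$. For a convergent semigroup $\mathcal{S}$ and $\mathcal{M}\subseteq\mathcal{S}$, a subset $\mathcal{A}\subseteq\mathcal{S}$ is a convergence core of $\mathcal{M}$ if for every infinite product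 $\prod_{i\in\mathbb{N}}S_i$ with all $S_i\in\mathcal{M}\cup\mathcal{A}$ there exists $k\in\mathbb{N}$ such that $\prod_{i>k}S_i\in\mathcal{A}$. *)

theory Defs
  imports "HOL-Analysis.Analysis" "HOL-Library.Disjoint_Sets"
begin

text \<open>The multiplication is an explicit parameter because the type-class product on
  \<^typ>\<open>real ^ 'n ^ 'n\<close> is the componentwise one; it will be instantiated with matrix
  multiplication.\<close>

definition topological_semigroup_on ::
  "('a::t2_space \<Rightarrow> 'a \<Rightarrow> 'a) \<Rightarrow> 'a set \<Rightarrow> bool" where
  "topological_semigroup_on f S \<longleftrightarrow>
     (\<forall>x\<in>S. \<forall>y\<in>S. f x y \<in> S) \<and>
     (\<forall>x\<in>S. \<forall>y\<in>S. \<forall>z\<in>S. f (f x y) z = f x (f y z)) \<and>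
     continuous_on (S \<times> S) (\<lambda>(x, y). f x y)"

primrec partial_product :: "('a \<Rightarrow> 'a \<Rightarrow> 'a) \<Rightarrow> (nat \<Rightarrow> 'a) \<Rightarrow> nat \<Rightarrow> 'a" where
  "partial_product f s 0 = s 0"
| "partial_product f s (Suc i) = f (partial_product f s i) (s (Suc i))"

definition has_infinite_product ::
  "('a::t2_space \<Rightarrow> 'a \<Rightarrow> 'a) \<Rightarrow> (nat \<Rightarrow> 'a) \<Rightarrow> 'a \<Rightarrow> bool" where
  "has_infinite_product f s L \<longleftrightarrow> partial_product f s \<longlonglongrightarrow> L"

definition convergent_semigroup :: "('a::t2_space \<Rightarrow> 'a \<Rightarrow> 'a) \<Rightarrow> 'a set \<Rightarrow> bool" where
  "convergent_semigroup f S \<longleftrightarrow>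
     topological_semigroup_on f S \<and>
     (\<forall>s. (\<forall>i. s i \<in> S) \<longrightarrow> (\<exists>L\<in>S. has_infinite_product f s L))"

text \<open>The ambient requirements (\<open>S\<close> is a convergent semigroup containing \<open>M\<close> and \<open>A\<close>) are
  part of the predicate. The product over the indices \<open>i > k\<close> is the infinite product of the
  shifted sequence.\<close>

definition convergence_core ::
  "('a::t2_space \<Rightarrow> 'a \<Rightarrow> 'a) \<Rightarrow> 'a set \<Rightarrow> 'a set \<Rightarrow> 'a set \<Rightarrow> bool" where
  "convergence_core f S M A \<longleftrightarrow>
     convergent_semigroup f S \<and> M \<subseteq> S \<and> A \<subseteq> S \<and>
     (\<forall>s. (\<forall>i. s i \<in> M \<union> A) \<longrightarrow>
        (\<exists>k. \<exists>L\<in>A. has_infinite_product f (\<lambda>i. s (Suc k + i)) L))"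

definition doubly_stochastic :: "(real ^ 'n ^ 'n) set" where
  "doubly_stochastic =
     {M. (\<forall>i j. 0 \<le> M $ i $ j) \<and>
         (\<forall>i. (\<Sum>j\<in>UNIV. M $ i $ j) = 1) \<and>
         (\<forall>j. (\<Sum>i\<in>UNIV. M $ i $ j) = 1)}"

definition domestic :: "real \<Rightarrow> (real ^ 'n ^ 'n) set" where
  "domestic \<epsilon> =
     {M \<in> doubly_stochastic.
        \<not> (\<exists>X Y. X \<noteq> Y \<and> card X = card Y \<and>
             (\<Sum>i\<in>X. \<Sum>j\<in>Y. M $ i $ j) > (1 - \<epsilon>) * real (card X))}"

definition averaging_over :: "real ^ 'n ^ 'n \<Rightarrow> 'n set set \<Rightarrow> bool" where
  "averaging_over A P \<longleftrightarrow>
     (\<forall>i j. (\<forall>p\<in>P. i \<in> p \<and> j \<in> p \<longrightarrow> A $ i $ j = 1 / real (card p)) \<and>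
            (\<not> (\<exists>p\<in>P. i \<in> p \<and> j \<in> p) \<longrightarrow> A $ i $ j = 0))"

definition averagings :: "(real ^ 'n ^ 'n) set" where
  "averagings = {A \<in> doubly_stochastic. \<exists>P. partition_on UNIV P \<and> averaging_over A P}"

end

theory Submission imports Defs begin

text \<open>For a row vector \<open>u\<close> let \<open>T m u\<close> be the sum of its \<open>m\<close> largest entries. Multiplication by a
  doubly stochastic matrix does not increase \<open>T m\<close>, and multiplication by an \<open>\<epsilon>\<close>-domestic matrix
  moves \<open>u\<close> by at most \<open>1/\<epsilon>\<close> times the total decrease of the \<open>T m\<close>; hence the partial products
  have bounded variation and converge. As there are finitely many averagings, only finitely many
  matrices occur as factors; past some index each of them recurs infinitely often, and the limit
  \<open>L\<close> of the remaining product satisfies \<open>L S = L\<close> for each remaining factor \<open>S\<close>. So \<open>L L = L\<close>, and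
  idempotent doubly stochastic matrices are averagings.\<close>

section \<open>Block sums of doubly stochastic matrices\<close>

definition block :: "real ^ 'n ^ 'n \<Rightarrow> 'n::finite set \<Rightarrow> 'n set \<Rightarrow> real" where
  "block M X Y = (\<Sum>i\<in>X. \<Sum>j\<in>Y. M $ i $ j)"

lemma doubly_stochasticD:
  assumes "M \<in> doubly_stochastic"
  shows "0 \<le> M $ i $ j" "(\<Sum>j\<in>UNIV. M $ i $ j) = 1" "(\<Sum>i\<in>UNIV. M $ i $ j) = 1"
  using assms by (auto simp: doubly_stochastic_def)

lemma block_swap: "block M X Y = (\<Sum>j\<in>Y. \<Sum>i\<in>X. M $ i $ j)"
  unfolding block_def by (rule sum.swap)

lemma block_transpose: "block (transpose M) X Y = block M Y X"
  unfolding block_swap[of M] by (simp add: block_def transpose_def)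

lemma transpose_doubly_stochastic:
  "M \<in> doubly_stochastic \<Longrightarrow> transpose M \<in> doubly_stochastic"
  by (auto simp: doubly_stochastic_def transpose_def)

lemma block_UNIV_right: "M \<in> doubly_stochastic \<Longrightarrow> block M X UNIV = real (card X)"
  by (simp add: block_def doubly_stochasticD)

lemma block_UNIV_left: "M \<in> doubly_stochastic \<Longrightarrow> block M UNIV Y = real (card Y)"
  by (simp add: block_swap doubly_stochasticD)

lemma block_nonneg: "M \<in> doubly_stochastic \<Longrightarrow> 0 \<le> block M X Y"
  by (auto simp: block_def intro!: sum_nonneg doubly_stochasticD)

lemma block_mono:
  assumes "M \<in> doubly_stochastic" "X \<subseteq> X'" "Y \<subseteq> Y'"
  shows "block M X Y \<le> block M X' Y'"
proof -
  have "block M X Y \<le> block M X Y'"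
    unfolding block_def using assms by (intro sum_mono sum_mono2) (auto intro: doubly_stochasticD)
  also have "\<dots> \<le> block M X' Y'"
    unfolding block_def using assms
    by (intro sum_mono2) (auto intro!: sum_nonneg doubly_stochasticD)
  finally show ?thesis .
qed

lemma block_Compl_right:
  "M \<in> doubly_stochastic \<Longrightarrow> block M X (- Y) = real (card X) - block M X Y"
proof -
  assume M: "M \<in> doubly_stochastic"
  have "block M X UNIV = block M X Y + block M X (- Y)"
    unfolding block_def sum.distrib[symmetric]
    by (intro sum.cong refl) (subst sum.union_disjoint[symmetric], auto)
  then show ?thesis using block_UNIV_right[OF M] by simp
qed

lemma block_Compl_left:
  "M \<in> doubly_stochastic \<Longrightarrow> block M (- X) Y = real (card Y) - block M X Y"
  using block_Compl_right[OF transpose_doubly_stochastic, of M Y X]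
  by (simp add: block_transpose)

lemma block_le_card_left: "M \<in> doubly_stochastic \<Longrightarrow> block M X Y \<le> real (card X)"
  using block_Compl_right[of M X Y] block_nonneg[of M X "- Y"] by simp

lemma block_le_card_right: "M \<in> doubly_stochastic \<Longrightarrow> block M X Y \<le> real (card Y)"
  using block_Compl_left[of M X Y] block_nonneg[of M "- X" Y] by simp

lemma block_sum_left: "block M X Y = (\<Sum>k\<in>X. block M {k} Y)"
  by (simp add: block_def)

lemma block_sum_right: "block M X Y = (\<Sum>k\<in>Y. block M X {k})"
  unfolding block_swap by (simp add: block_def)

text \<open>Turns a block of a product into the pairing of column sums of \<open>M\<close> over
  \<open>X\<close> with row sums of \<open>N\<close> over \<open>Y\<close>, the form in which vector
  estimates apply.\<close>

lemma block_mult: "block (M ** N) X Y = (\<Sum>k\<in>UNIV. block M X {k} * block N {k} Y)"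
proof -
  have "block (M ** N) X Y = (\<Sum>i\<in>X. \<Sum>k\<in>UNIV. \<Sum>j\<in>Y. M $ i $ k * N $ k $ j)"
    unfolding block_def matrix_matrix_mult_def
    by (simp add: sum.swap[of _ Y UNIV])
  also have "\<dots> = (\<Sum>k\<in>UNIV. \<Sum>i\<in>X. \<Sum>j\<in>Y. M $ i $ k * N $ k $ j)"
    by (rule sum.swap)
  also have "\<dots> = (\<Sum>k\<in>UNIV. block M X {k} * block N {k} Y)"
    by (simp add: block_def sum_product)
  finally show ?thesis .
qed

lemma domestic_iff:
  "M \<in> domestic \<epsilon> \<longleftrightarrow> M \<in> doubly_stochastic \<and>
     (\<forall>X Y. X \<noteq> Y \<longrightarrow> card X = card Y \<longrightarrow> block M X Y \<le> (1 - \<epsilon>) * real (card X))"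
  unfolding domestic_def block_def by (auto simp: not_less)

lemma doubly_stochastic_mult:
  assumes "M \<in> doubly_stochastic" "N \<in> doubly_stochastic"
  shows "M ** N \<in> doubly_stochastic"
proof -
  have "(\<Sum>j\<in>UNIV. (M ** N) $ i $ j) = 1" for i
  proof -
    have "block (M ** N) {i} UNIV = block M {i} UNIV"
      unfolding block_mult block_sum_right[of M "{i}" UNIV]
      by (simp add: block_UNIV_right[OF assms(2)])
    then show ?thesis by (simp add: block_UNIV_right[OF assms(1)]) (simp add: block_def)
  qed
  moreover have "(\<Sum>i\<in>UNIV. (M ** N) $ i $ j) = 1" for j
  proof -
    have "block (M ** N) UNIV {j} = block N UNIV {j}"
      unfolding block_mult block_sum_left[of N UNIV "{j}"]
      by (simp add: block_UNIV_left[OF assms(1)])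
    then show ?thesis by (simp add: block_UNIV_left[OF assms(2)]) (simp add: block_def)
  qed
  moreover have "0 \<le> (M ** N) $ i $ j" for i j
    using assms by (auto simp: matrix_matrix_mult_def intro!: sum_nonneg mult_nonneg_nonneg doubly_stochasticD)
  ultimately show ?thesis by (auto simp: doubly_stochastic_def)
qed

section \<open>Layers of a vector and a rearrangement inequality\<close>

text \<open>\<^term>\<open>X m\<close> consists of \<^term>\<open>m\<close> indices carrying the largest values of \<^term>\<open>u\<close>, and
  \<^term>\<open>g m\<close> is the drop from the \<^term>\<open>m\<close>-th largest value to the next one, the value after the
  last being \<^term>\<open>0\<close>; hence \<^term>\<open>g CARD('n)\<close> may be negative.\<close>

definition layers :: "('n::finite \<Rightarrow> real) \<Rightarrow> (nat \<Rightarrow> 'n set) \<Rightarrow> (nat \<Rightarrow> real) \<Rightarrow> bool" where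
  "layers u X g \<longleftrightarrow>
     (\<forall>m\<le>CARD('n). card (X m) = m) \<and> mono X \<and> (\<forall>m<CARD('n). 0 \<le> g m) \<and>
     (\<forall>c. u c = (\<Sum>m=1..CARD('n). g m * indicator (X m) c))"

lemma layers_exist:
  fixes u :: "'n::finite \<Rightarrow> real"
  shows "\<exists>X g. layers u X g"
proof -
  obtain xs :: "'n list" where xs: "set xs = UNIV" "distinct xs"
    using finite_distinct_list[OF finite[of UNIV]] by blast
  define ys where "ys = sort_key (\<lambda>i. - u i) xs"
  have ys: "set ys = UNIV" "distinct ys" "sorted (map (\<lambda>i. - u i) ys)"
    using xs by (auto simp: ys_def)
  define n where "n = CARD('n)"
  have len: "length ys = n"
    using distinct_card[OF ys(2)] ys(1) by (simp add: n_def)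
  define X where "X m = (!) ys ` {..<m}" for m
  \<comment> \<open>The default \<open>0\<close> beyond the last entry lets the telescoping sum end
    at \<open>v n = 0\<close>, leaving \<open>u c\<close>.\<close>
  define v where "v m = (if m < n then u (ys ! m) else 0)" for m
  \<comment> \<open>Truncated subtraction gives \<open>g 0 = 0\<close>, so the sign condition of
    \<open>layers\<close> also holds at \<open>m = 0\<close>.\<close>
  define g where "g m = v (m - 1) - v m" for m
  have inj: "inj_on ((!) ys) {..<n}"
    using inj_on_nth[OF ys(2), of "{..<n}"] len by simp
  have "card (X m) = m" if "m \<le> n" for m
    unfolding X_def using that by (subst card_image) (auto intro: inj_on_subset[OF inj])
  moreover have "mono X"
    by (auto simp: X_def mono_def)
  moreover have "0 \<le> g m" if "m < n" for m
    using sorted_nth_mono[OF ys(3), of "m - 1" m] that len by (auto simp: g_def v_def)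
  moreover have "u c = (\<Sum>m=1..n. g m * indicator (X m) c)" for c
  proof -
    obtain j where j: "j < n" "c = ys ! j"
      using ys(1) len by (metis UNIV_I in_set_conv_nth)
    have telescope: "(\<Sum>m=Suc j..N. g m) = v j - v N" if "j \<le> N" for N
      using that by (induction N rule: dec_induct) (auto simp: g_def)
    have X: "c \<in> X m \<longleftrightarrow> j < m" if "m \<le> n" for m
      unfolding X_def j(2) using inj_on_image_mem_iff[OF inj, of j "{..<m}"] that j(1) by auto
    have "(\<Sum>m=1..n. g m * indicator (X m) c) = (\<Sum>m=1..n. if m \<in> {j<..} then g m else 0)"
      by (rule sum.cong) (auto simp: X)
    also have "\<dots> = (\<Sum>m\<in>{1..n} \<inter> {j<..}. g m)"
      by (rule sum.inter_restrict[symmetric]) simp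
    also have "{1..n} \<inter> {j<..} = {Suc j..n}" by auto
    also have "(\<Sum>m=Suc j..n. g m) = v j - v n"
      using telescope[of n] j(1) by simp
    also have "\<dots> = u c"
      using j by (simp add: v_def)
    finally show ?thesis by simp
  qed
  ultimately show ?thesis
    unfolding layers_def n_def by blast
qed

text \<open>Summation by parts, with the drops between consecutive sorted values as weights.\<close>

lemma layers_sum_mult:
  fixes u :: "'n::finite \<Rightarrow> real"
  assumes "layers u X g"
  shows "(\<Sum>k\<in>UNIV. u k * b k) = (\<Sum>l=1..CARD('n). g l * sum b (X l))"
proof -
  have u: "u k = (\<Sum>l=1..CARD('n). g l * indicator (X l) k)" for k
    using assms by (simp add: layers_def)
  have "(\<Sum>k\<in>UNIV. u k * b k) = (\<Sum>k\<in>UNIV. \<Sum>l=1..CARD('n). g l * (indicator (X l) k * b k))"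
    unfolding u sum_distrib_right mult.assoc ..
  also have "\<dots> = (\<Sum>l=1..CARD('n). \<Sum>k\<in>UNIV. g l * (indicator (X l) k * b k))"
    by (rule sum.swap)
  finally show ?thesis
    by (simp add: sum_distrib_left[symmetric] indicator_times_eq_if sum.If_cases)
qed

text \<open>A rearrangement inequality with remainder. After summation by parts the gap is the sum
  of the terms \<open>g l * (card (X l \<inter> X m) - sum b (X l))\<close>. The terms with
  \<open>l \<noteq> m\<close> are nonnegative because the mass of \<open>b\<close> on
  \<open>X l\<close> is at most both \<open>l\<close> and \<open>m\<close>; the term
  \<open>l = m\<close> is the remainder.\<close>

lemma layers_pairing_le:
  fixes u b :: "'n::finite \<Rightarrow> real"
  assumes L: "layers u X g" and b: "\<And>k. 0 \<le> b k" "\<And>k. b k \<le> 1"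
    and m: "sum b UNIV = real m" "1 \<le> m" "m \<le> CARD('n)"
  shows "(\<Sum>k\<in>UNIV. u k * b k) \<le> sum u (X m) - g m * (real m - sum b (X m))"
proof -
  let ?n = "CARD('n)"
  have card: "card (X l) = l" if "l \<le> ?n" for l using L that by (simp add: layers_def)
  have g: "0 \<le> g l" if "l < ?n" for l using L that by (simp add: layers_def)
  have mono: "X k \<subseteq> X l" if "k \<le> l" for k l using L that by (auto simp: layers_def dest: monoD)
  have top: "X ?n = UNIV" using card[of ?n] by (simp add: card_eq_UNIV_imp_eq_UNIV)
  let ?d = "\<lambda>l. g l * (real (card (X l \<inter> X m)) - sum b (X l))"
  have "sum u (X m) = (\<Sum>k\<in>UNIV. u k * indicator (X m) k)"
    by (simp add: indicator_def if_distrib sum.If_cases cong: if_cong)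
  also have "\<dots> = (\<Sum>l=1..?n. g l * real (card (X l \<inter> X m)))"
    unfolding layers_sum_mult[OF L] by (simp add: indicator_def sum.If_cases Int_def)
  finally have "sum u (X m) - (\<Sum>k\<in>UNIV. u k * b k) = (\<Sum>l=1..?n. ?d l)"
    unfolding layers_sum_mult[OF L] by (simp add: sum_subtractf algebra_simps)
  moreover have "?d m \<le> (\<Sum>l=1..?n. ?d l)"
  proof (rule member_le_sum)
    fix l assume "l \<in> {1..?n} - {m}"
    then have l: "l \<le> ?n" by simp
    show "0 \<le> ?d l"
    proof (cases "l = ?n")
      \<comment> \<open>Here \<open>X l\<close> is everything and both masses equal
        \<open>m\<close>, so the term vanishes even if \<open>g l\<close> is negative.\<close>
      case True
      then show ?thesis using top m card by simp
    next
      case False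
      have "sum b (X l) \<le> real (card (X l \<inter> X m))"
      proof (cases "l \<le> m")
        case True
        then have "X l \<inter> X m = X l" using mono by blast
        then show ?thesis using sum_mono[of "X l" b "\<lambda>_. 1"] b by simp
      next
        case False
        then have "X l \<inter> X m = X m" using mono[of m l] by auto
        then show ?thesis
          using sum_mono2[of UNIV "X l" b] b card[OF m(3)] m(1) by simp
      qed
      then show ?thesis using g l False by simp
    qed
  qed (use m in auto)
  ultimately show ?thesis using card[OF m(3)] by simp
qed

section \<open>Closure of the domestic matrices under multiplication\<close>

text \<open>On \<open>X - Y\<close> and \<open>Y - X\<close> the numbers \<open>a k - 1/2\<close> and \<open>b k - 1/2\<close> have opposite signs, which
  improves \<open>a k * b k \<le> (a k + b k) / 2\<close> by \<open>1/4\<close>; there are at least two such indices.\<close>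

lemma sum_mult_concentrated_le:
  fixes a b :: "'n::finite \<Rightarrow> real"
  assumes a: "\<And>k. 0 \<le> a k" "\<And>k. a k \<le> 1" "sum a UNIV = real m" "real m - 1/2 \<le> sum a X"
    and b: "\<And>k. 0 \<le> b k" "\<And>k. b k \<le> 1" "sum b UNIV = real m" "real m - 1/2 \<le> sum b Y"
    and XY: "card X = m" "card Y = m" "X \<noteq> Y"
  shows "(\<Sum>k\<in>UNIV. a k * b k) \<le> real m - 1/2"
proof -
  \<comment> \<open>The other \<open>m - 1\<close> entries on \<open>Z\<close> sum to at most
    \<open>m - 1\<close>, so \<open>c k\<close> is at least \<open>1/2\<close>; at most
    \<open>1/2\<close> of the total mass lies outside \<open>Z\<close>, which bounds
    \<open>c l\<close>.\<close>
  have conc: "1/2 \<le> c k \<and> c l \<le> 1/2"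
    if c: "\<And>k. 0 \<le> c k" "\<And>k. c k \<le> 1" "sum c UNIV = real m" "real m - 1/2 \<le> sum c Z"
      and Z: "card Z = m" "k \<in> Z" "l \<notin> Z" for c :: "'n \<Rightarrow> real" and Z k l
  proof
    have "sum c Z = c k + sum c (Z - {k})" using Z by (simp add: sum.remove)
    moreover have "sum c (Z - {k}) \<le> real (card (Z - {k}))"
      using sum_mono[of "Z - {k}" c "\<lambda>_. 1"] c by simp
    moreover have "real (card (Z - {k})) = real m - 1"
      using Z
      by (simp add: card_Diff_singleton)
        (metis One_nat_def Suc_leI card_gt_0_iff empty_iff finite of_nat_1 of_nat_diff)
    ultimately show "1/2 \<le> c k" using c(4) by simp
    have "c l + sum c Z = sum c (insert l Z)" using Z by simp
    also have "\<dots> \<le> sum c UNIV" by (rule sum_mono2) (auto intro: c)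
    finally show "c l \<le> 1/2" using c by simp
  qed
  obtain x where x: "x \<in> X" "x \<notin> Y"
    using XY by (metis card_subset_eq finite subsetI)
  obtain y where y: "y \<in> Y" "y \<notin> X"
    using XY by (metis card_subset_eq finite subsetI)
  have neq: "x \<noteq> y" using x y by auto
  have ax: "1/2 \<le> a x" "a y \<le> 1/2" using conc[OF a XY(1) x(1) y(2)] by auto
  have bx: "1/2 \<le> b y" "b x \<le> 1/2" using conc[OF b XY(2) y(1) x(2)] by auto
  have le: "a k * b k \<le> (a k + b k) / 2" for k
    using mult_left_mono[OF b(2)[of k] a(1)[of k]] mult_right_mono[OF a(2)[of k] b(1)[of k]] by simp
  have "0 \<le> (a x - 1/2) * (1/2 - b x)" "0 \<le> (1/2 - a y) * (b y - 1/2)"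
    using ax bx by simp_all
  then have le': "a x * b x \<le> (a x + b x) / 2 - 1/4" "a y * b y \<le> (a y + b y) / 2 - 1/4"
    by (simp_all add: algebra_simps)
  have "a k * b k \<le> (a k + b k) / 2 - (if k \<in> {x, y} then 1/4 else 0)" for k
    using le le' by auto
  then have "(\<Sum>k\<in>UNIV. a k * b k) \<le> (\<Sum>k\<in>UNIV. (a k + b k) / 2 - (if k \<in> {x, y} then 1/4 else 0))"
    by (intro sum_mono)
  also have "\<dots> = (sum a UNIV + sum b UNIV) / 2 - 1/2"
    unfolding sum_subtractf sum_divide_distrib[symmetric] sum.distrib
    using neq by (simp only: sum.If_cases[OF finite] Collect_mem_eq) simp
  finally show ?thesis using a(3) b(3) by simp
qed

text \<open>A violating pair \<open>X\<close>, \<open>Y\<close> gives vectors \<open>a\<close>,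
  \<open>b\<close> whose pairing exceeds \<open>(1 - \<epsilon>) * m\<close>. The pairing is at most
  the sum of the \<open>m\<close> largest entries of either vector. Domesticity of \<open>M\<close>
  and \<open>N\<close> then forces \<open>a\<close> to concentrate on \<open>X\<close> and
  \<open>b\<close> on \<open>Y\<close>; as these sets differ, the pairing is at most
  \<open>m - 1/2\<close>, a contradiction.\<close>

lemma domestic_mult:
  fixes M N :: "real ^ 'n::finite ^ 'n"
  assumes eps: "0 < \<epsilon>" "\<epsilon> \<le> inverse (2 * real CARD('n))"
    and M: "M \<in> domestic \<epsilon>" and N: "N \<in> domestic \<epsilon>"
  shows "M ** N \<in> domestic \<epsilon>"
proof -
  have ds: "M \<in> doubly_stochastic" "N \<in> doubly_stochastic"
    using M N by (auto simp: domestic_iff)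
  have "block (M ** N) X Y \<le> (1 - \<epsilon>) * real (card X)" if XY: "X \<noteq> Y" "card X = card Y" for X Y
  proof (rule ccontr)
    define m where "m = card X"
    define a where "a k = block M X {k}" for k
    define b where "b k = block N {k} Y" for k
    assume "\<not> ?thesis"
    then have gt: "(1 - \<epsilon>) * real m < (\<Sum>k\<in>UNIV. a k * b k)"
      by (simp add: block_mult a_def b_def m_def)
    have "m \<noteq> 0" using XY by (auto simp: m_def)
    moreover have "m \<le> CARD('n)" by (simp add: m_def card_mono)
    ultimately have m: "1 \<le> m" "m \<le> CARD('n)" by simp_all
    \<comment> \<open>The upper bound on \<open>\<epsilon>\<close> gives
      \<open>\<epsilon> * m \<le> 1/2\<close>, so a violation means losing less than
      \<open>1/2\<close>.\<close>
    have "\<epsilon> * real m \<le> inverse (2 * real CARD('n)) * real CARD('n)"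
      using eps m by (intro mult_mono) auto
    then have half: "real m - 1/2 \<le> (1 - \<epsilon>) * real m" by (simp add: algebra_simps)
    have a: "0 \<le> a k" "a k \<le> 1" "sum a UNIV = real m" for k
      using block_nonneg[OF ds(1)] block_le_card_right[OF ds(1), of X "{k}"] block_UNIV_right[OF ds(1)]
        block_sum_right[of M X UNIV] by (auto simp: a_def m_def)
    have b: "0 \<le> b k" "b k \<le> 1" "sum b UNIV = real m" for k
      using block_nonneg[OF ds(2)] block_le_card_left[OF ds(2), of "{k}" Y] block_UNIV_left[OF ds(2)]
        block_sum_left[of N UNIV Y] XY by (auto simp: b_def m_def)
    have top: "\<exists>Z. card Z = m \<and> (\<Sum>k\<in>UNIV. c k * d k) \<le> sum c Z"
      if d: "\<And>k. 0 \<le> d k" "\<And>k. d k \<le> 1" "sum d UNIV = real m" for c d :: "'n \<Rightarrow> real"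
    proof -
      obtain X g where L: "layers c X g" using layers_exist by blast
      have card: "card (X m) = m" using L m by (auto simp: layers_def)
      have "0 \<le> g m * (real m - sum d (X m))"
      proof (cases "m = CARD('n)")
        case True
        then have "X m = UNIV" using card by (simp add: card_eq_UNIV_imp_eq_UNIV)
        then show ?thesis using d by simp
      next
        case False
        then show ?thesis using L m sum_mono2[of UNIV "X m" d] d by (auto simp: layers_def)
      qed
      then show ?thesis using layers_pairing_le[OF L d m] card by (intro exI[of _ "X m"]) auto
    qed
    obtain Z where Z: "card Z = m" "(\<Sum>k\<in>UNIV. a k * b k) \<le> sum a Z" using top[OF b] by blast
    have "block M X Z = sum a Z" unfolding a_def by (rule block_sum_right)
    then have "\<not> block M X Z \<le> (1 - \<epsilon>) * real (card X)" using Z gt by (simp add: m_def)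
    \<comment> \<open>Any other set of size \<open>m\<close> would carry too much mass for a
      domestic \<open>M\<close>.\<close>
    then have "Z = X" using M Z(1) unfolding domestic_iff m_def by metis
    obtain W where W: "card W = m" "(\<Sum>k\<in>UNIV. b k * a k) \<le> sum b W" using top[OF a] by blast
    have "block N W Y = sum b W" unfolding b_def by (rule block_sum_left)
    then have "\<not> block N W Y \<le> (1 - \<epsilon>) * real (card W)" using W gt by (simp add: mult.commute)
    then have "W = Y" using N W(1) XY(2) unfolding domestic_iff m_def by metis
    have "(\<Sum>k\<in>UNIV. a k * b k) \<le> real m - 1/2"
    proof (rule sum_mult_concentrated_le[OF a _ b])
      show "real m - 1/2 \<le> sum a X" using Z gt half \<open>Z = X\<close> by simp
      show "real m - 1/2 \<le> sum b Y" using W gt half \<open>W = Y\<close> by (simp add: mult.commute)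
    qed (use XY in \<open>simp_all add: m_def\<close>)
    then show False using gt half by simp
  qed
  then show ?thesis using doubly_stochastic_mult[OF ds] by (simp add: domestic_iff)
qed

section \<open>Top sums as a potential and convergence of infinite products\<close>

text \<open>The maximum over \<open>m\<close>-element sets avoids choosing an ordering; for
  \<open>m\<close> above \<open>CARD('n)\<close> it ranges over the empty set.\<close>

definition top_sum :: "nat \<Rightarrow> ('n::finite \<Rightarrow> real) \<Rightarrow> real" where
  "top_sum m u = Max (sum u ` {Z. card Z = m})"

lemma top_sum_ge: "card Z = m \<Longrightarrow> sum u Z \<le> top_sum m u"
  unfolding top_sum_def by (intro Max_ge) auto

lemma top_sum_attained:
  fixes u :: "'n::finite \<Rightarrow> real"
  assumes "m \<le> CARD('n)"
  obtains Y where "card Y = m" "top_sum m u = sum u Y"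
proof -
  obtain Z :: "'n set" where "card Z = m"
    using obtain_subset_with_card_n[OF assms] by metis
  then have "top_sum m u \<in> sum u ` {Z. card Z = m}"
    unfolding top_sum_def by (intro Max_in) auto
  then show ?thesis using that by auto
qed

text \<open>Equals the sum of \<open>CARD('n) + 1 - j\<close> times the \<open>j\<close>-th largest
  entry, and serves as the potential.\<close>

definition ordered_sum :: "('n::finite \<Rightarrow> real) \<Rightarrow> real" where
  "ordered_sum u = (\<Sum>m=1..CARD('n). top_sum m u)"

text \<open>The total variation of an orbit is controlled by a monotone potential. For a layer \<open>X m\<close>,
  either the top set of \<open>u'\<close> is still \<open>X m\<close>, and the mass leaving it is lost to the potential, or
  it has changed, and then domesticity forces a loss proportional to \<open>\<epsilon>\<close>.\<close>

lemma domestic_step_le: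
  fixes u u' :: "'n::finite \<Rightarrow> real" and S :: "real ^ 'n ^ 'n"
  assumes eps: "0 < \<epsilon>" "\<epsilon> \<le> 1" and S: "S \<in> domestic \<epsilon>"
    and u': "\<And>j. u' j = (\<Sum>k\<in>UNIV. u k * S $ k $ j)"
  shows "\<epsilon> * \<bar>u' c - u c\<bar> \<le> ordered_sum u - ordered_sum u'"
proof -
  let ?n = "CARD('n)"
  have ds: "S \<in> doubly_stochastic" using S by (simp add: domestic_iff)
  obtain X g where L: "layers u X g" using layers_exist by blast
  have card: "card (X l) = l" if "l \<le> ?n" for l using L that by (simp add: layers_def)
  have g: "0 \<le> g l" if "l < ?n" for l using L that by (simp add: layers_def)
  have top: "X ?n = UNIV" using card[of ?n] by (simp add: card_eq_UNIV_imp_eq_UNIV)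
  let ?d = "\<lambda>m. g m * (real m - block S (X m) (X m))"
  have drop: "\<epsilon> * ?d m \<le> top_sum m u - top_sum m u'" if m: "1 \<le> m" "m \<le> ?n" for m
  proof -
    obtain Y where Y: "card Y = m" "top_sum m u' = sum u' Y"
      using top_sum_attained[OF m(2)] by blast
    define b where "b k = block S {k} Y" for k
    have b: "0 \<le> b k" "b k \<le> 1" "sum b UNIV = real m" for k
      using block_nonneg[OF ds] block_le_card_left[OF ds, of "{k}" Y] block_UNIV_left[OF ds]
        block_sum_left[of S UNIV Y] Y by (auto simp: b_def)
    have "sum u' Y = (\<Sum>k\<in>UNIV. u k * b k)"
      unfolding u' b_def block_def by (subst sum.swap) (simp add: sum_distrib_left)
    also have "\<dots> \<le> sum u (X m) - g m * (real m - sum b (X m))"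
      by (rule layers_pairing_le[OF L b m])
    also have "sum b (X m) = block S (X m) Y" unfolding b_def by (rule block_sum_left[symmetric])
    finally have 1: "g m * (real m - block S (X m) Y) \<le> top_sum m u - top_sum m u'"
      using top_sum_ge[OF card[OF m(2)], of u] Y by simp
    have le: "0 \<le> real m - block S (X m) (X m)" "real m - block S (X m) (X m) \<le> real m"
      using block_le_card_left[OF ds, of "X m" "X m"] card[OF m(2)] block_nonneg[OF ds] by auto
    have 2: "\<epsilon> * (real m - block S (X m) (X m)) \<le> real m - block S (X m) Y"
    proof (cases "Y = X m")
      case True
      then show ?thesis using mult_right_mono[OF eps(2) le(1)] by simp
    next
      case False
      have "\<epsilon> * (real m - block S (X m) (X m)) \<le> \<epsilon> * real m"
        using eps le by simp
      also have "block S (X m) Y \<le> (1 - \<epsilon>) * real m"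
        using S False Y card[OF m(2)] by (metis domestic_iff)
      then have "\<epsilon> * real m \<le> real m - block S (X m) Y" by (simp add: algebra_simps)
      finally show ?thesis .
    qed
    \<comment> \<open>For \<open>m = CARD('n)\<close> both sides are zero, which covers a negative
      \<open>g m\<close>; otherwise the previous bound is multiplied by \<open>g m\<close>.\<close>
    have "\<epsilon> * ?d m \<le> g m * (real m - block S (X m) Y)"
    proof (cases "m = ?n")
      case True
      then show ?thesis using top Y block_UNIV_left[OF ds] by simp
    next
      case False
      then show ?thesis using mult_left_mono[OF 2 g[of m]] m by (simp add: mult.left_commute)
    qed
    then show ?thesis using 1 by simp
  qed
  \<comment> \<open>The change is the pairing of \<open>u\<close> with column \<open>c\<close> of
    \<open>S\<close> minus the identity, so summation by parts applies.\<close>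
  have "u' c - u c = (\<Sum>k\<in>UNIV. u k * (S $ k $ c - (if k = c then 1 else 0)))"
    unfolding u' right_diff_distrib sum_subtractf by (simp add: if_distrib cong: if_cong)
  also have "\<dots> = (\<Sum>l=1..?n. g l * (block S (X l) {c} - indicator (X l) c))"
    unfolding layers_sum_mult[OF L]
    by (simp add: block_def sum_subtractf indicator_def of_bool_def)
  finally have "\<bar>u' c - u c\<bar> \<le> (\<Sum>l=1..?n. \<bar>g l * (block S (X l) {c} - indicator (X l) c)\<bar>)"
    by simp
  also have "\<dots> \<le> (\<Sum>l=1..?n. ?d l)"
  proof (rule sum_mono)
    fix l assume l: "l \<in> {1..?n}"
    show "\<bar>g l * (block S (X l) {c} - indicator (X l) c)\<bar> \<le> ?d l"
    proof (cases "l = ?n")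
      case True
      then show ?thesis using top block_UNIV_left[OF ds] by simp
    next
      case False
      \<comment> \<open>For \<open>c\<close> in \<open>X l\<close> the left side is the mass
        entering \<open>c\<close> from outside \<open>X l\<close>, otherwise the mass reaching
        \<open>c\<close> from \<open>X l\<close>. The total mass entering \<open>X l\<close> equals
        the total mass leaving it, and this is the right side.\<close>
      have "\<bar>block S (X l) {c} - indicator (X l) c\<bar> \<le> real l - block S (X l) (X l)"
      proof (cases "c \<in> X l")
        case True
        then have "block S (- X l) {c} \<le> block S (- X l) (X l)"
          by (intro block_mono[OF ds]) auto
        then show ?thesis
          using True block_Compl_left[OF ds, of "X l"] card[of l] l block_le_card_right[OF ds, of "X l" "{c}"]
          by simp
      next
        case c: False
        then have "block S (X l) {c} \<le> block S (X l) (- X l)"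
          by (intro block_mono[OF ds]) auto
        then show ?thesis
          using c block_Compl_right[OF ds, of "X l"] card[of l] l block_nonneg[OF ds, of "X l" "{c}"]
          by simp
      qed
      then show ?thesis using g[of l] False l by (simp add: abs_mult mult_left_mono)
    qed
  qed
  finally have "\<epsilon> * \<bar>u' c - u c\<bar> \<le> \<epsilon> * (\<Sum>l=1..?n. ?d l)"
    using eps by simp
  also have "\<dots> = (\<Sum>l=1..?n. \<epsilon> * ?d l)" by (rule sum_distrib_left)
  also have "\<dots> \<le> (\<Sum>l=1..?n. top_sum l u - top_sum l u')"
    using drop by (intro sum_mono) auto
  finally show ?thesis by (simp add: ordered_sum_def sum_subtractf)
qed

lemma ordered_sum_nonneg:
  fixes u :: "'n::finite \<Rightarrow> real"
  assumes "\<And>c. 0 \<le> u c"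
  shows "0 \<le> ordered_sum u"
  unfolding ordered_sum_def
proof (rule sum_nonneg)
  fix m assume "m \<in> {1..CARD('n)}"
  then obtain Y where "card Y = m" "top_sum m u = sum u Y"
    using top_sum_attained[of m u] by auto
  then show "0 \<le> top_sum m u" using assms by (simp add: sum_nonneg)
qed

text \<open>Both \<open>F\<close> and \<open>\<epsilon> * x + F\<close> are decreasing and bounded
  below, so their difference converges.\<close>

lemma convergent_if_variation_le_potential_drop:
  fixes x F :: "nat \<Rightarrow> real"
  assumes "0 < \<epsilon>" and step: "\<And>i. \<epsilon> * \<bar>x (Suc i) - x i\<bar> \<le> F i - F (Suc i)"
    and pos: "\<And>i. 0 \<le> x i" "\<And>i. 0 \<le> F i"
  shows "convergent x"
proof -
  have "0 \<le> F i - F (Suc i)" for i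
    using order_trans[OF _ step[of i], of 0] assms(1) by simp
  then have "decseq F" by (intro decseq_SucI) (simp add: algebra_simps)
  then have F: "convergent F"
    using decseq_convergent[of F 0] pos(2) by (metis convergentI)
  have "\<epsilon> * x (Suc i) + F (Suc i) \<le> \<epsilon> * x i + F i" for i
  proof -
    have "\<epsilon> * (x (Suc i) - x i) \<le> \<epsilon> * \<bar>x (Suc i) - x i\<bar>" using assms(1) by simp
    then show ?thesis using step[of i] by (simp add: algebra_simps)
  qed
  then have "decseq (\<lambda>i. \<epsilon> * x i + F i)" by (intro decseq_SucI)
  then have "convergent (\<lambda>i. \<epsilon> * x i + F i)"
    using decseq_convergent[of "\<lambda>i. \<epsilon> * x i + F i" 0] pos assms(1)
    by (metis add_nonneg_nonneg convergentI less_imp_le mult_nonneg_nonneg)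
  from convergent_diff[OF this F] have "convergent (\<lambda>i. \<epsilon> * x i)" by simp
  then show ?thesis using assms(1) by (simp add: convergent_mult_const_iff)
qed

text \<open>The strict inequality of the definition occurs negated, so only weak inequalities and
  equations remain.\<close>

lemma closed_domestic: "closed (domestic \<epsilon> :: (real ^ 'n ^ 'n) set)"
proof -
  have "domestic \<epsilon> = {M :: real ^ 'n ^ 'n. (\<forall>i j. 0 \<le> M $ i $ j) \<and>
      (\<forall>i. (\<Sum>j\<in>UNIV. M $ i $ j) = 1) \<and> (\<forall>j. (\<Sum>i\<in>UNIV. M $ i $ j) = 1) \<and>
      (\<forall>X Y. X \<noteq> Y \<longrightarrow> card X = card Y \<longrightarrow>
        (\<Sum>i\<in>X. \<Sum>j\<in>Y. M $ i $ j) \<le> (1 - \<epsilon>) * real (card X))}"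
    by (simp add: set_eq_iff domestic_iff doubly_stochastic_def block_def conj_assoc)
  also have "closed \<dots>"
    by (intro closed_Collect_conj closed_Collect_all closed_Collect_imp open_Collect_const
        closed_Collect_le closed_Collect_eq continuous_intros)
  finally show ?thesis .
qed

lemma partial_product_in:
  "(\<And>x y. x \<in> S \<Longrightarrow> y \<in> S \<Longrightarrow> f x y \<in> S) \<Longrightarrow> (\<And>i. s i \<in> S) \<Longrightarrow> partial_product f s i \<in> S"
  by (induction i) auto

text \<open>A fixed row of the partial products is a nonnegative vector that is multiplied on the
  right by one factor at a time, so its variation is paid for by \<open>ordered_sum\<close> and each
  entry converges. Closedness keeps the limit domestic.\<close>

lemma domestic_infinite_product:
  fixes s :: "nat \<Rightarrow> real ^ 'n::finite ^ 'n"
  assumes eps: "0 < \<epsilon>" "\<epsilon> \<le> inverse (2 * real CARD('n))" and s: "\<And>i. s i \<in> domestic \<epsilon>"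
  shows "\<exists>L\<in>domestic \<epsilon>. has_infinite_product (**) s L"
proof -
  let ?p = "partial_product (**) s"
  have p: "?p i \<in> domestic \<epsilon>" for i
    by (intro partial_product_in domestic_mult eps s)
  have nonneg: "0 \<le> ?p i $ r $ c" for i r c
    using p[of i] by (auto simp: domestic_iff doubly_stochasticD)
  have "inverse (2 * real CARD('n)) \<le> 1"
    using inverse_le_1_iff[of "2 * real CARD('n)"] zero_less_card_finite[where 'a='n] by linarith
  then have "\<epsilon> \<le> 1" using eps by simp
  have "convergent (\<lambda>i. ?p i $ r $ c)" for r c
  proof (rule convergent_if_variation_le_potential_drop[OF eps(1)])
    show "\<epsilon> * \<bar>?p (Suc i) $ r $ c - ?p i $ r $ c\<bar>
        \<le> ordered_sum (($) (?p i $ r)) - ordered_sum (($) (?p (Suc i) $ r))" for i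
      by (rule domestic_step_le[OF eps(1) \<open>\<epsilon> \<le> 1\<close> s]) (simp add: matrix_matrix_mult_def)
  qed (auto intro: nonneg ordered_sum_nonneg)
  then obtain l where l: "(\<lambda>i. ?p i $ r $ c) \<longlonglongrightarrow> l r c" for r c
    unfolding convergent_def by metis
  have "?p \<longlonglongrightarrow> (\<chi> r c. l r c)"
    by (intro vec_tendstoI) (simp add: l)
  moreover from this have "(\<chi> r c. l r c) \<in> domestic \<epsilon>"
    using closed_sequentially[of "domestic \<epsilon>" ?p] closed_domestic p by blast
  ultimately show ?thesis unfolding has_infinite_product_def by blast
qed

lemma tendsto_matrix_mult:
  fixes A B :: "real ^ 'n::finite ^ 'n"
  assumes "(f \<longlongrightarrow> A) F" "(h \<longlongrightarrow> B) F"
  shows "((\<lambda>x. f x ** h x) \<longlongrightarrow> A ** B) F"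
  unfolding matrix_matrix_mult_def by (intro tendsto_intros assms)

lemma convergent_semigroup_domestic:
  assumes "0 < \<epsilon>" "\<epsilon> \<le> inverse (2 * real CARD('n::finite))"
  shows "convergent_semigroup (**) (domestic \<epsilon> :: (real ^ 'n ^ 'n) set)"
proof -
  have "continuous_on A (\<lambda>(x, y). x ** y)" for A :: "((real ^ 'n ^ 'n) \<times> (real ^ 'n ^ 'n)) set"
    unfolding case_prod_beta matrix_matrix_mult_def
    by (intro continuous_intros)
  then show ?thesis
    unfolding convergent_semigroup_def topological_semigroup_on_def
    using domestic_mult[OF assms] domestic_infinite_product[OF assms]
    by (auto simp: matrix_mul_assoc)
qed

section \<open>Averagings are domestic and finite in number\<close>

lemma sum_card_Int_partition:
  fixes X :: "'n::finite set"
  assumes "partition_on UNIV P"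
  shows "(\<Sum>p\<in>P. card (X \<inter> p)) = card X"
proof -
  have "card (\<Union>p\<in>P. X \<inter> p) = (\<Sum>p\<in>P. card (X \<inter> p))"
    using assms by (intro card_UN_disjoint) (auto simp: partition_on_def disjoint_def)
  moreover have "(\<Union>p\<in>P. X \<inter> p) = X"
    using assms by (auto simp: partition_on_def)
  ultimately show ?thesis by simp
qed

text \<open>Some part \<open>p\<close> meets \<open>X\<close>, is not contained in \<open>Y\<close>,
  and has no more points of \<open>Y\<close> than of \<open>X\<close>. From the rows in
  \<open>X \<inter> p\<close> mass at least \<open>1/2\<close> goes to \<open>p - Y\<close>, and
  \<open>1/2\<close> is at least \<open>\<epsilon> * card X\<close>.\<close>

lemma averagings_subset_domestic:
  assumes eps: "0 < \<epsilon>" "\<epsilon> \<le> inverse (2 * real CARD('n::finite))"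
  shows "(averagings :: (real ^ 'n ^ 'n) set) \<subseteq> domestic \<epsilon>"
proof
  fix A :: "real ^ 'n ^ 'n" assume "A \<in> averagings"
  then obtain P where ds: "A \<in> doubly_stochastic" and P: "partition_on UNIV P" and avg: "averaging_over A P"
    by (auto simp: averagings_def)
  have "block A X Y \<le> (1 - \<epsilon>) * real (card X)" if XY: "X \<noteq> Y" "card X = card Y" for X Y
  proof -
    obtain x where x: "x \<in> X" "x \<notin> Y"
      using XY by (metis card_subset_eq finite subsetI)
    obtain p0 where p0: "p0 \<in> P" "x \<in> p0" using P unfolding partition_on_def by blast
    have lt: "card (Y \<inter> p0) < card p0" using x p0 by (intro psubset_card_mono) auto
    have gt: "0 < card (X \<inter> p0)" using x p0 by (auto simp: card_gt_0_iff)
    have "\<exists>p\<in>P. 0 < card (X \<inter> p) \<and> card (Y \<inter> p) \<le> card (X \<inter> p) \<and> card (Y \<inter> p) < card p"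
    proof (cases "card (Y \<inter> p0) \<le> card (X \<inter> p0)")
      case True
      then show ?thesis using p0 lt gt by blast
    next
      case False
      \<comment> \<open>An excess of \<open>Y\<close> in \<open>p0\<close> must be balanced by a
        deficit in another part, since \<open>X\<close> and \<open>Y\<close> have equal
        size.\<close>
      have "\<exists>p\<in>P. card (Y \<inter> p) < card (X \<inter> p)"
      proof (rule ccontr)
        assume "\<not> ?thesis"
        then have "(\<Sum>p\<in>P. card (X \<inter> p)) < (\<Sum>p\<in>P. card (Y \<inter> p))"
          using False p0 by (intro sum_strict_mono_ex1) (auto simp: not_less not_le)
        then show False using XY sum_card_Int_partition[OF P] by simp
      qed
      then obtain p where p: "p \<in> P" "card (Y \<inter> p) < card (X \<inter> p)" by blast
      moreover have "card (X \<inter> p) \<le> card p" by (intro card_mono) auto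
      ultimately show ?thesis by (intro bexI[of _ p]) auto
    qed
    then obtain p where p: "p \<in> P" and gt: "0 < card (X \<inter> p)"
      and le: "card (Y \<inter> p) \<le> card (X \<inter> p)" and lt: "card (Y \<inter> p) < card p" by blast
    define q where "q = card p"
    define a where "a = card (X \<inter> p)"
    define b where "b = card (p - Y)"
    have q: "q = b + card (Y \<inter> p)"
      using card_Int_Diff[of p Y] by (simp add: q_def b_def Int_commute)
    have ab: "1 \<le> a" "1 \<le> b" "q \<le> a + b" using gt lt le q by (auto simp: a_def q_def)
    \<comment> \<open>This yields \<open>a * b \<ge> a + b - 1\<close>; adding
      \<open>a * b \<ge> 1\<close> gives \<open>2 * a * b \<ge> a + b \<ge> q\<close>.\<close>
    have "0 \<le> (real a - 1) * (real b - 1)" using ab by simp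
    then have "real a + real b - 1 \<le> real a * real b" by (simp add: algebra_simps)
    moreover have "1 \<le> real a * real b" using ab mult_mono[of 1 "real a" 1 "real b"] by simp
    moreover have "real q \<le> real a + real b" using ab by linarith
    ultimately have "real q \<le> 2 * (real a * real b)" by linarith
    moreover have "0 < q" using q ab by simp
    ultimately have "1/2 \<le> real a * real b / real q" by (simp add: field_simps)
    also have "\<dots> = block A (X \<inter> p) (p - Y)"
    proof -
      have "A $ i $ j = 1 / real q" if "i \<in> p" "j \<in> p" for i j
        using avg p that by (auto simp: averaging_over_def q_def)
      then have "block A (X \<inter> p) (p - Y) = (\<Sum>i\<in>X \<inter> p. \<Sum>j\<in>p - Y. 1 / real q)"
        unfolding block_def by (intro sum.cong) auto
      then show ?thesis by (simp add: a_def b_def)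
    qed
    also have "\<dots> \<le> block A X (- Y)" by (intro block_mono[OF ds]) auto
    finally have "block A X Y \<le> real (card X) - 1/2" using block_Compl_right[OF ds, of X Y] by simp
    moreover have "\<epsilon> * real (card X) \<le> inverse (2 * real CARD('n)) * real CARD('n)"
      using eps by (intro mult_mono) (auto simp: card_mono)
    ultimately show ?thesis by (simp add: algebra_simps)
  qed
  then show "A \<in> domestic \<epsilon>" using ds by (simp add: domestic_iff)
qed

text \<open>The partition determines the matrix, and a finite type has finitely many set
  systems.\<close>

lemma finite_averagings: "finite (averagings :: (real ^ 'n::finite ^ 'n) set)"
proof -
  have uniq: "A = B" if "averaging_over A P" "averaging_over B P"
    for P :: "'n set set" and A B :: "real ^ 'n ^ 'n"
  proof -
    have "A $ i $ j = B $ i $ j" for i j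
    proof (cases "\<exists>p\<in>P. i \<in> p \<and> j \<in> p")
      case True
      then obtain p where "p \<in> P" "i \<in> p \<and> j \<in> p" by blast
      then show ?thesis using that by (simp add: averaging_over_def)
    next
      case False
      then show ?thesis using that by (simp add: averaging_over_def)
    qed
    then show ?thesis by (simp add: vec_eq_iff)
  qed
  have "averagings \<subseteq> range (\<lambda>P :: 'n set set. THE A. averaging_over A P)"
  proof
    fix A :: "real ^ 'n ^ 'n" assume "A \<in> averagings"
    then obtain P where "averaging_over A P" by (auto simp: averagings_def)
    then have "A = (THE A. averaging_over A P)" using uniq by (intro the_equality[symmetric])
    then show "A \<in> range (\<lambda>P. THE A. averaging_over A P)" by (rule range_eqI)
  qed
  then show ?thesis by (rule finite_subset) simp
qed

section \<open>Idempotent doubly stochastic matrices\<close>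

text \<open>Equality in Jensen's inequality: each column \<open>c\<close> satisfies \<open>L c = c\<close>, so
  \<open>\<Sum> L i k (c k - c i)\<^sup>2 = 0\<close>.\<close>

lemma doubly_stochastic_idempotent_rows_eq:
  fixes L :: "real ^ 'n::finite ^ 'n"
  assumes ds: "L \<in> doubly_stochastic" and idem: "L ** L = L" and pos: "0 < L $ i $ k"
  shows "L $ k $ j = L $ i $ j"
proof -
  let ?c = "\<lambda>i. L $ i $ j"
  have Lc: "(\<Sum>k\<in>UNIV. L $ i $ k * ?c k) = ?c i" for i
    using arg_cong[OF idem, of "\<lambda>M. M $ i $ j"] by (simp add: matrix_matrix_mult_def)
  \<comment> \<open>With \<open>q\<close> the sum of the squares of the column, the three sums are
    \<open>q\<close> by column sums, \<open>2 * q\<close> by \<open>Lc\<close>, and \<open>q\<close>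
    by row sums.\<close>
  have "(\<Sum>i\<in>UNIV. \<Sum>k\<in>UNIV. L $ i $ k * (?c k - ?c i)\<^sup>2) =
      (\<Sum>i\<in>UNIV. \<Sum>k\<in>UNIV. L $ i $ k * (?c k)\<^sup>2)
      - (\<Sum>i\<in>UNIV. \<Sum>k\<in>UNIV. 2 * ?c i * (L $ i $ k * ?c k))
      + (\<Sum>i\<in>UNIV. \<Sum>k\<in>UNIV. L $ i $ k * (?c i)\<^sup>2)"
    unfolding sum_subtractf[symmetric] sum.distrib[symmetric]
    by (intro sum.cong refl) (simp add: power2_eq_square algebra_simps)
  also have "(\<Sum>i\<in>UNIV. \<Sum>k\<in>UNIV. L $ i $ k * (?c k)\<^sup>2) = (\<Sum>k\<in>UNIV. (?c k)\<^sup>2)"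
    by (subst sum.swap) (simp add: sum_distrib_right[symmetric] doubly_stochasticD[OF ds])
  also have "(\<Sum>i\<in>UNIV. \<Sum>k\<in>UNIV. 2 * ?c i * (L $ i $ k * ?c k)) = 2 * (\<Sum>k\<in>UNIV. (?c k)\<^sup>2)"
    by (simp only: sum_distrib_left[symmetric] Lc) (simp add: sum_distrib_left power2_eq_square mult.assoc)
  also have "(\<Sum>i\<in>UNIV. \<Sum>k\<in>UNIV. L $ i $ k * (?c i)\<^sup>2) = (\<Sum>k\<in>UNIV. (?c k)\<^sup>2)"
    by (simp add: sum_distrib_right[symmetric] doubly_stochasticD[OF ds])
  finally have "(\<Sum>i\<in>UNIV. \<Sum>k\<in>UNIV. L $ i $ k * (?c k - ?c i)\<^sup>2) = 0" by simp
  then have "L $ i $ k * (?c k - ?c i)\<^sup>2 = 0"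
    using doubly_stochasticD(1)[OF ds] by (simp add: sum_nonneg_eq_0_iff sum_nonneg)
  then show ?thesis using pos by simp
qed

text \<open>A positive entry at \<open>i\<close>, \<open>k\<close> makes rows \<open>i\<close> and
  \<open>k\<close> equal and, by transposition, columns \<open>i\<close> and \<open>k\<close> equal.
  Hence the row supports partition the indices, each row is constant on its support, and the row sum
  fixes the constant.\<close>

lemma doubly_stochastic_idempotent_averaging:
  fixes L :: "real ^ 'n::finite ^ 'n"
  assumes ds: "L \<in> doubly_stochastic" and idem: "L ** L = L"
  shows "L \<in> averagings"
proof -
  note rows = doubly_stochastic_idempotent_rows_eq[OF ds idem]
  have idemT: "transpose L ** transpose L = transpose L"
    by (metis idem matrix_transpose_mul)
  have cols: "L $ j $ k = L $ j $ i" if "0 < L $ i $ k" for i j k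
    using doubly_stochastic_idempotent_rows_eq[OF transpose_doubly_stochastic[OF ds] idemT, of k i j] that
    by (simp add: transpose_def)
  define C where "C i = {k. 0 < L $ i $ k}" for i
  have diag: "0 < L $ i $ i" for i
  proof -
    have "\<exists>k. 0 < L $ i $ k"
    proof (rule ccontr)
      assume "\<not> ?thesis"
      then have "L $ i $ k = 0" for k using doubly_stochasticD(1)[OF ds, of i k] by (metis order_le_less)
      then show False using doubly_stochasticD(2)[OF ds, of i] by simp
    qed
    \<comment> \<open>Column equality, read in row \<open>i\<close> itself, carries the positive
      entry to the diagonal.\<close>
    then show ?thesis using cols by metis
  qed
  have C_eq: "C k = C i" if "k \<in> C i" for i k
    using rows that by (simp add: C_def)
  have val: "L $ i $ k = 1 / real (card (C i))" if "k \<in> C i" for i k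
  proof -
    have eq: "L $ i $ k = L $ i $ i" if "k \<in> C i" for k using cols that by (auto simp: C_def)
    have "1 = (\<Sum>k\<in>UNIV. L $ i $ k)" using doubly_stochasticD(2)[OF ds, of i] by simp
    also have "\<dots> = (\<Sum>k\<in>C i. L $ i $ k)"
      using doubly_stochasticD(1)[OF ds] by (intro sum.mono_neutral_right) (auto simp: C_def not_less order_antisym)
    also have "\<dots> = real (card (C i)) * L $ i $ i" using eq by simp
    finally show ?thesis using eq[OF that]
      by (metis mult_eq_0_iff nonzero_mult_div_cancel_left zero_neq_one)
  qed
  have mem: "i \<in> C i" for i using diag by (simp add: C_def)
  have "partition_on UNIV (range C)"
  proof (rule partition_onI)
    show "disjnt p q" if "p \<in> range C" "q \<in> range C" "p \<noteq> q" for p q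
      using that C_eq unfolding disjnt_iff by (metis rangeE)
  qed (use mem in auto)
  moreover have "averaging_over L (range C)"
    unfolding averaging_over_def
  proof (intro allI conjI ballI impI)
    fix i j p assume "p \<in> range C" "i \<in> p \<and> j \<in> p"
    then have "p = C i" "j \<in> C i" using C_eq by auto
    then show "L $ i $ j = 1 / real (card p)" using val by simp
  next
    fix i j assume "\<not> (\<exists>p\<in>range C. i \<in> p \<and> j \<in> p)"
    then have "j \<notin> C i" using mem by auto
    then show "L $ i $ j = 0" using doubly_stochasticD(1)[OF ds, of i j] by (simp add: C_def)
  qed
  ultimately show ?thesis using ds by (auto simp: averagings_def)
qed

section \<open>Recurrent factors and the limit of the tail\<close>

text \<open>Finitely many values occur only finitely often; \<open>k\<close> bounds all their
  occurrences.\<close>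

lemma eventually_recurrent:
  fixes s :: "nat \<Rightarrow> 'a"
  assumes "finite (range s)"
  obtains k where "\<And>i. k < i \<Longrightarrow> \<exists>\<^sub>\<infinity>j. s j = s i"
proof -
  let ?B = "{x \<in> range s. \<not> (\<exists>\<^sub>\<infinity>j. s j = x)}"
  have "finite (\<Union>x\<in>?B. {j. s j = x})"
    using assms by (intro finite_UN_I) (auto simp: INFM_iff_infinite)
  then have "\<exists>k. \<forall>j\<in>\<Union>x\<in>?B. {j. s j = x}. j \<le> k"
    by (simp only: finite_nat_set_iff_bounded_le)
  then obtain k where k: "\<forall>j\<in>\<Union>x\<in>?B. {j. s j = x}. j \<le> k" ..
  have "\<exists>\<^sub>\<infinity>j. s j = s i" if "k < i" for i
  proof (rule ccontr)
    assume "\<not> (\<exists>\<^sub>\<infinity>j. s j = s i)"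
    then have "s i \<in> ?B" by (intro CollectI conjI rangeI)
    then have "i \<in> (\<Union>x\<in>?B. {j. s j = x})" by (rule UN_I) simp
    from bspec[OF k this] show False using that by simp
  qed
  then show ?thesis using that by blast
qed

text \<open>Whenever \<open>A\<close> is the next factor, multiplying the partial product by
  \<open>A\<close> gives the next partial product. So a sequence with limit
  \<open>L ** A - L\<close> vanishes infinitely often.\<close>

lemma infinite_product_absorbs_recurrent:
  fixes s :: "nat \<Rightarrow> real ^ 'n::finite ^ 'n"
  assumes "has_infinite_product (**) s L" and rec: "\<exists>\<^sub>\<infinity>j. s j = A"
  shows "L ** A = L"
proof -
  let ?p = "partial_product (**) s"
  have p: "?p \<longlonglongrightarrow> L" using assms by (simp add: has_infinite_product_def)
  have "(\<lambda>i. ?p i ** A - ?p (Suc i)) \<longlonglongrightarrow> L ** A - L"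
  proof (intro tendsto_diff)
    show "(\<lambda>i. ?p (Suc i)) \<longlonglongrightarrow> L" using p by (rule LIMSEQ_Suc)
    show "(\<lambda>i. ?p i ** A) \<longlonglongrightarrow> L ** A"
      by (intro tendsto_matrix_mult tendsto_const p)
  qed
  moreover have "\<exists>\<^sub>\<infinity>i. ?p i ** A - ?p (Suc i) = 0"
    unfolding INFM_nat_le
  proof
    fix m
    obtain j where "Suc m \<le> j" "s j = A" using rec by (auto simp: INFM_nat_le)
    then show "\<exists>i\<ge>m. ?p i ** A - ?p (Suc i) = 0"
      \<comment> \<open>The factor with index \<open>j\<close> enters in the step from
        \<open>j - 1\<close> to \<open>j\<close>; \<open>Suc m \<le> j\<close> excludes the initial
        factor.\<close>
      by (intro exI[of _ "j - 1"]) (cases j; auto)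
  qed
  ultimately have "L ** A - L = 0"
    using tendsto_imp_eventually_ne[of "\<lambda>i. ?p i ** A - ?p (Suc i)" "L ** A - L" sequentially 0]
    by (auto simp: frequently_def cofinite_eq_sequentially)
  then show ?thesis by simp
qed

text \<open>Absorbing every factor, \<open>L\<close> absorbs every partial product on the right, and
  hence their limit.\<close>

lemma infinite_product_recurrent_idempotent:
  fixes s :: "nat \<Rightarrow> real ^ 'n::finite ^ 'n"
  assumes L: "has_infinite_product (**) s L" and rec: "\<And>i. \<exists>\<^sub>\<infinity>j. s j = s i"
  shows "L ** L = L"
proof -
  let ?p = "partial_product (**) s"
  have p: "?p \<longlonglongrightarrow> L" using L by (simp add: has_infinite_product_def)
  have absorb: "L ** s i = L" for i by (rule infinite_product_absorbs_recurrent[OF L rec])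
  have "L ** ?p i = L" for i
    by (induction i) (simp_all add: absorb matrix_mul_assoc)
  moreover have "(\<lambda>i. L ** ?p i) \<longlonglongrightarrow> L ** L"
    by (intro tendsto_matrix_mult tendsto_const p)
  ultimately show ?thesis by (simp add: LIMSEQ_const_iff)
qed

theorem theorem5p9:
  fixes \<epsilon> :: real and M :: "(real ^ 'n ^ 'n) set"
  assumes "0 < \<epsilon>" and "\<epsilon> \<le> inverse (2 * real CARD('n))"
    and "finite M" and "M \<subseteq> domestic \<epsilon>"
  shows "convergence_core (**) (domestic \<epsilon>) M averagings"
proof -
  note eps = assms(1,2)
  have "\<exists>k. \<exists>L\<in>averagings. has_infinite_product (**) (\<lambda>i. s (Suc k + i)) L"
    if s: "\<forall>i. s i \<in> M \<union> averagings" for s :: "nat \<Rightarrow> real ^ 'n ^ 'n"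
  proof -
    have "finite (range s)"
      using s assms(3) finite_averagings by (intro finite_subset[of "range s" "M \<union> averagings"]) auto
    then obtain k where k: "\<And>i. k < i \<Longrightarrow> \<exists>\<^sub>\<infinity>j. s j = s i"
      by (rule eventually_recurrent) blast
    define t where "t i = s (Suc k + i)" for i
    have t: "t i \<in> domestic \<epsilon>" for i
      using s assms(4) averagings_subset_domestic[OF eps] by (auto simp: t_def)
    from domestic_infinite_product[OF eps t]
    obtain L where L: "L \<in> domestic \<epsilon>" "has_infinite_product (**) t L" ..
    \<comment> \<open>Recurrence passes to the tail: an occurrence in \<open>s\<close> at or after
      \<open>Suc k + m\<close> is one in \<open>t\<close> at or after \<open>m\<close>.\<close>
    have "\<exists>\<^sub>\<infinity>j. t j = t i" for i
      unfolding INFM_nat_le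
    proof
      fix m
      have "k < Suc k + i" by simp
      from k[OF this] have "\<exists>j\<ge>Suc k + m. s j = t i"
        unfolding INFM_nat_le t_def by (rule spec)
      then obtain j where "Suc k + m \<le> j" "s j = t i" by (elim exE conjE)
      then show "\<exists>j\<ge>m. t j = t i" by (intro exI[of _ "j - Suc k"]) (auto simp: t_def)
    qed
    then have "L ** L = L" by (rule infinite_product_recurrent_idempotent[OF L(2)])
    then have "L \<in> averagings"
      using L(1) by (intro doubly_stochastic_idempotent_averaging) (auto simp: domestic_iff)
    then show ?thesis using L(2) unfolding t_def by blast
  qed
  then show ?thesis
    unfolding convergence_core_def
    using convergent_semigroup_domestic[OF eps] averagings_subset_domestic[OF eps] assms(4) by blast
qed

end
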